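(* Let $S_1,S_2\subseteq\mathbb{Z}^{+}$. Let $\widetilde{L}_{S_1,S_2}(x,y)=\sum_{M}\frac{x^{r(M)}}{r(M)!}\frac{y^{c(M)}}{c(M)!}$, where the sum runs over all $(S_1,S_2)$-restricted lonesum matrices $M$ (of all sizes, all-zero rows and columns allowed), and $r(M)$, $c(M)$ are the numbers of rows and columns of $M$. Then, as formal power series, $$\widetilde{L}_{S_1,S_2}(x,y)=\frac{1+E_{S_1}(x)+E_{S_2}(y)+E_{S_1}(x)E_{S_2}(y)}{1-E_{S_1}(x)E_{S_2}(y)}.$$
   Context: $\mathbb{Z}^{+}$ is the set of positive integers. For $S\subseteq\mathbb{Z}^{+}$, $E_S(x)=\sum_{s\in S}\frac{x^s}{s!}$. A lonesum matrix is a $(0,1)$-matrix that is uniquely determined, among $(0,1)$-matrices of the same size, by its row sum vector and column sum vector. Two rows (resp. columns) of a matrix have the same type if they coincide in every position. A lonesum matrix is $(S_1,S_2)$-restricted if for every row occurring in it (including an all-zero row), the number of rows of the same type belongs to $S_1$, and for every column occurring in it (including an all-zero column), the number of columns of the same type belongs to $S_2$. Convention for empty matrices: for each $n,k$ with $nk=0$ there is exactly one $n\times k$ matrix, and it is lonesum; all $n$ rows of an $n\times 0$ matrix are of the same (all-zero) type, and all $k$ columns of a $0\times k$ matrix are of the same (all-zero) type. *)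

theory Defs
  imports Jordan_Normal_Form.Matrix "HOL-Computational_Algebra.Formal_Power_Series"
begin

definition zero_one_mat :: "nat mat \<Rightarrow> bool" where
  "zero_one_mat A \<longleftrightarrow> elements_mat A \<subseteq> {0, 1}"

definition row_sum_vec :: "nat mat \<Rightarrow> nat vec" where
  "row_sum_vec A = vec (dim_row A) (\<lambda>i. \<Sum>j<dim_col A. A $$ (i, j))"

definition col_sum_vec :: "nat mat \<Rightarrow> nat vec" where
  "col_sum_vec A = vec (dim_col A) (\<lambda>j. \<Sum>i<dim_row A. A $$ (i, j))"

definition lonesum :: "nat mat \<Rightarrow> bool" where
  "lonesum A \<longleftrightarrow> zero_one_mat A \<and>
     (\<forall>B \<in> carrier_mat (dim_row A) (dim_col A).
        zero_one_mat B \<and> row_sum_vec B = row_sum_vec A \<and> col_sum_vec B = col_sum_vec A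
          \<longrightarrow> B = A)"

(* For every n and k, also if n = 0 or k = 0, carrier_mat n k is the set of n x k matrices;
   it has a single element if n * k = 0.  All rows of an n x 0 matrix are the empty vector
   and hence of the same type; likewise for the columns of a 0 x k matrix. *)
definition restricted_lonesum :: "nat set \<Rightarrow> nat set \<Rightarrow> nat mat \<Rightarrow> bool" where
  "restricted_lonesum S1 S2 A \<longleftrightarrow> lonesum A \<and>
     (\<forall>i < dim_row A. card {i'. i' < dim_row A \<and> row A i' = row A i} \<in> S1) \<and>
     (\<forall>j < dim_col A. card {j'. j' < dim_col A \<and> col A j' = col A j} \<in> S2)"

definition E :: "nat set \<Rightarrow> rat fps" where
  "E S = Abs_fps (\<lambda>s. if s \<in> S then 1 / fact s else 0)"

(* Power series in x and y are elements of rat fps fps: the outer variable is y and the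
   coefficients are power series in x, so the coefficient of x^n y^k in F is
   fps_nth (fps_nth F k) n.  A univariate f gives f(x) and f(y) as follows. *)
definition in_x :: "rat fps \<Rightarrow> rat fps fps" where
  "in_x f = fps_const f"

definition in_y :: "rat fps \<Rightarrow> rat fps fps" where
  "in_y f = Abs_fps (\<lambda>k. fps_const (fps_nth f k))"

(* The formal sum over all matrices M is taken coefficientwise: the monomial of M contributes to
   x^n y^k iff M has n rows and k columns, which holds for finitely many M only. *)
definition lonesum_gf :: "nat set \<Rightarrow> nat set \<Rightarrow> rat fps fps" where
  "lonesum_gf S1 S2 = Abs_fps (\<lambda>k. Abs_fps (\<lambda>n.
     \<Sum>M \<in> {M \<in> carrier_mat n k. restricted_lonesum S1 S2 M}.
       1 / fact (dim_row M) * (1 / fact (dim_col M))))"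

lemma finite_restricted_lonesum: "finite {M \<in> carrier_mat n k. restricted_lonesum S1 S2 M}"
proof (rule finite_subset)
  let ?g = "\<lambda>P. mat n k (\<lambda>p. if p \<in> P then 1 else 0 :: nat)"
  show "{M \<in> carrier_mat n k. restricted_lonesum S1 S2 M} \<subseteq> ?g ` Pow ({..<n} \<times> {..<k})"
  proof
    fix M :: "nat mat"
    assume M: "M \<in> {M \<in> carrier_mat n k. restricted_lonesum S1 S2 M}"
    then have "elements_mat M \<subseteq> {0, 1}"
      by (simp add: restricted_lonesum_def lonesum_def zero_one_mat_def)
    moreover have "M $$ (i, j) \<in> elements_mat M" if "i < n" "j < k" for i j
      using M that by (intro elements_matI[of M n k i j]) auto
    ultimately have "M $$ (i, j) \<in> {0, 1}" if "i < n" "j < k" for i j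
      using that by blast
    then have "M = ?g {(i, j). i < n \<and> j < k \<and> M $$ (i, j) = 1}"
      using M by (intro eq_matI) auto
    then show "M \<in> ?g ` Pow ({..<n} \<times> {..<k})" by (rule image_eqI) auto
  qed
qed simp

(* Since rat fps is not a field, division on rat fps fps is not exact in general; here the
   denominator has constant coefficient 1 and is invertible, so division by it is genuine. *)
lemma lonesum_denominator_divide:
  assumes "0 \<notin> S2"
  shows "F / (1 - in_x (E S1) * in_y (E S2)) * (1 - in_x (E S1) * in_y (E S2)) = F"
proof -
  let ?d = "1 - in_x (E S1) * in_y (E S2)"
  have d0: "fps_nth ?d 0 = 1"
    using assms by (simp add: in_x_def in_y_def E_def)
  have "subdegree ?d = 0" by (rule subdegree_eq_0) (simp only: d0, simp)
  then have "F / ?d = F * inverse ?d" by (rule fps_divide_unit')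
  moreover have "inverse ?d * ?d = 1"
  proof -
    have "inverse (fps_nth ?d 0) = 1" by (simp only: d0 fps_inverse_one)
    then have "inverse ?d = fps_right_inverse ?d 1" by (simp only: fps_inverse_def)
    moreover have "?d * fps_right_inverse ?d 1 = 1"
      by (rule fps_right_inverse) (simp only: d0 mult_1_right)
    ultimately show ?thesis by (simp only: mult.commute)
  qed
  ultimately show ?thesis by (simp add: mult.assoc)
qed

end

theory Submission
  imports Defs
begin

text \<open>
  A 0-1 matrix is lonesum iff its support is a Ferrers relation, that is, iff its rows are linearly
  ordered by inclusion. Among the restricted matrices, let \<open>P\<close> be the series of those
  without a zero row and \<open>Q\<close> the series of those without a column full of ones.
  Deleting all zero rows shows \<open>L = (1 + E\<^sub>1(x)) P\<close>; deleting all full columns shows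
  \<open>L = (1 + E\<^sub>2(y)) Q\<close>, which is the same fact under complementation and
  transposition. A Ferrers relation other than the one of size 0 by 0 has either a zero row or a
  full column, but not both, so \<open>L + 1 = P + Q\<close>. Eliminating \<open>P\<close> and
  \<open>Q\<close> gives the formula.
\<close>

subsection \<open>Ferrers relations\<close>

text \<open>The excluded pattern is a 2 x 2 submatrix equal to one of the two permutation
  matrices.\<close>

definition ferrers :: "('a \<times> 'b) set \<Rightarrow> bool" where
  "ferrers T \<longleftrightarrow>
     (\<forall>i j i' j'. (i, j) \<in> T \<and> (i', j') \<in> T \<longrightarrow> (i, j') \<in> T \<or> (i', j) \<in> T)"

text \<open>The carriers \<open>R\<close> and \<open>C\<close> are explicit because a set of pairs
  does not record its zero rows and columns; letting them be arbitrary permits passing to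
  \<open>R - Z\<close>.\<close>

definition restricted_ferrers ::
  "nat set \<Rightarrow> nat set \<Rightarrow> 'a set \<Rightarrow> 'b set \<Rightarrow> ('a \<times> 'b) set set" where
  "restricted_ferrers S1 S2 R C = {T. T \<subseteq> R \<times> C \<and> ferrers T \<and>
     (\<forall>i\<in>R. card {i' \<in> R. T `` {i'} = T `` {i}} \<in> S1) \<and>
     (\<forall>j\<in>C. card {j' \<in> C. T\<inverse> `` {j'} = T\<inverse> `` {j}} \<in> S2)}"

definition no_zero_row ::
  "nat set \<Rightarrow> nat set \<Rightarrow> 'a set \<Rightarrow> 'b set \<Rightarrow> ('a \<times> 'b) set set" where
  "no_zero_row S1 S2 R C = {T \<in> restricted_ferrers S1 S2 R C. \<forall>i\<in>R. T `` {i} \<noteq> {}}"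

definition no_full_column ::
  "nat set \<Rightarrow> nat set \<Rightarrow> 'a set \<Rightarrow> 'b set \<Rightarrow> ('a \<times> 'b) set set" where
  "no_full_column S1 S2 R C = {T \<in> restricted_ferrers S1 S2 R C. \<forall>j\<in>C. T\<inverse> `` {j} \<noteq> R}"

section \<open>Complementation combined with transposition\<close>

text \<open>Transposition alone would send full columns to full rows; the complement turns these
  into zero rows.\<close>

definition co_converse :: "'a set \<Rightarrow> 'b set \<Rightarrow> ('a \<times> 'b) set \<Rightarrow> ('b \<times> 'a) set" where
  "co_converse R C T = (C \<times> R) - T\<inverse>"

lemma ferrers_rows_chain:
  assumes "ferrers T"
  shows "T `` {i} \<subseteq> T `` {i'} \<or> T `` {i'} \<subseteq> T `` {i}"
  using assms unfolding ferrers_def by blast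

lemma ferrers_converse: "ferrers T \<Longrightarrow> ferrers (T\<inverse>)"
  unfolding ferrers_def by blast

lemma finite_restricted_ferrers:
  assumes "finite R" "finite C"
  shows "finite (restricted_ferrers S1 S2 R C)"
  by (rule finite_subset[of _ "Pow (R \<times> C)"]) (use assms in \<open>auto simp: restricted_ferrers_def\<close>)

lemma finite_no_zero_row:
  "finite R \<Longrightarrow> finite C \<Longrightarrow> finite (no_zero_row S1 S2 R C)"
  by (simp add: no_zero_row_def finite_restricted_ferrers)

lemma finite_no_full_column:
  "finite R \<Longrightarrow> finite C \<Longrightarrow> finite (no_full_column S1 S2 R C)"
  by (simp add: no_full_column_def finite_restricted_ferrers)

lemma co_converse_co_converse: "T \<subseteq> R \<times> C \<Longrightarrow> co_converse C R (co_converse R C T) = T"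
  unfolding co_converse_def by blast

text \<open>Complementation within the carriers is injective on rows and on columns, so types keep
  their sizes, and it exchanges the two excluded 2 x 2 patterns.\<close>

lemma co_converse_mem:
  assumes "T \<in> restricted_ferrers S1 S2 R C"
  shows "co_converse R C T \<in> restricted_ferrers S2 S1 C R"
proof -
  let ?U = "co_converse R C T"
  have T: "T \<subseteq> R \<times> C" "ferrers T"
    using assms by (auto simp: restricted_ferrers_def)
  have rows: "?U `` {j} = R - T\<inverse> `` {j}" if "j \<in> C" for j
    using that by (auto simp: co_converse_def)
  have cols: "?U\<inverse> `` {i} = C - T `` {i}" if "i \<in> R" for i
    using that by (auto simp: co_converse_def)
  have 1: "{j' \<in> C. ?U `` {j'} = ?U `` {j}} = {j' \<in> C. T\<inverse> `` {j'} = T\<inverse> `` {j}}"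
    if "j \<in> C" for j
  proof -
    have "R - T\<inverse> `` {j'} = R - T\<inverse> `` {j} \<longleftrightarrow> T\<inverse> `` {j'} = T\<inverse> `` {j}" for j'
      using T(1) by blast
    then show ?thesis using that rows by (simp cong: conj_cong)
  qed
  have 2: "{i' \<in> R. ?U\<inverse> `` {i'} = ?U\<inverse> `` {i}} = {i' \<in> R. T `` {i'} = T `` {i}}"
    if "i \<in> R" for i
  proof -
    have "C - T `` {i'} = C - T `` {i} \<longleftrightarrow> T `` {i'} = T `` {i}" for i'
      using T(1) by blast
    then show ?thesis using that cols by (simp cong: conj_cong)
  qed
  have "ferrers ?U"
    using T(2) unfolding ferrers_def co_converse_def by blast
  moreover have "?U \<subseteq> C \<times> R" by (auto simp: co_converse_def)
  ultimately show ?thesis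
    using assms 1 2 by (simp add: restricted_ferrers_def)
qed

lemma restricted_ferrers_subset: "T \<in> restricted_ferrers S1 S2 R C \<Longrightarrow> T \<subseteq> R \<times> C"
  by (simp add: restricted_ferrers_def)

lemma card_restricted_ferrers_swap:
  "card (restricted_ferrers S1 S2 R C) = card (restricted_ferrers S2 S1 C R)"
proof (rule bij_betw_same_card)
  show "bij_betw (co_converse R C) (restricted_ferrers S1 S2 R C) (restricted_ferrers S2 S1 C R)"
    by (rule bij_betw_byWitness[where f' = "co_converse C R"])
      (simp_all add: co_converse_co_converse restricted_ferrers_subset image_subset_iff co_converse_mem)
qed

lemma co_converse_zero_row_iff:
  assumes "T \<subseteq> R \<times> C" "j \<in> C"
  shows "co_converse R C T `` {j} = {} \<longleftrightarrow> T\<inverse> `` {j} = R"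
  using assms unfolding co_converse_def by blast

lemma co_converse_full_column_iff:
  assumes "T \<subseteq> R \<times> C" "i \<in> R"
  shows "(co_converse R C T)\<inverse> `` {i} = C \<longleftrightarrow> T `` {i} = {}"
  using assms unfolding co_converse_def by blast

lemma co_converse_no_zero_row:
  assumes "T \<in> no_full_column S1 S2 R C"
  shows "co_converse R C T \<in> no_zero_row S2 S1 C R"
proof -
  have T: "T \<in> restricted_ferrers S1 S2 R C" using assms by (simp add: no_full_column_def)
  show ?thesis
    using assms co_converse_mem[OF T] co_converse_zero_row_iff[OF restricted_ferrers_subset[OF T]]
    unfolding no_full_column_def no_zero_row_def by blast
qed

lemma co_converse_no_full_column:
  assumes "T \<in> no_zero_row S1 S2 R C"
  shows "co_converse R C T \<in> no_full_column S2 S1 C R"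
proof -
  have T: "T \<in> restricted_ferrers S1 S2 R C" using assms by (simp add: no_zero_row_def)
  show ?thesis
    using assms co_converse_mem[OF T] co_converse_full_column_iff[OF restricted_ferrers_subset[OF T]]
    unfolding no_full_column_def no_zero_row_def by blast
qed

lemma card_no_full_column: "card (no_full_column S1 S2 R C) = card (no_zero_row S2 S1 C R)"
proof (rule bij_betw_same_card)
  have "co_converse C R (co_converse R C T) = T" if "T \<in> no_full_column S1 S2 R C" for T
    using that by (intro co_converse_co_converse restricted_ferrers_subset[of _ S1 S2]) (simp add: no_full_column_def)
  moreover have "co_converse R C (co_converse C R T) = T" if "T \<in> no_zero_row S2 S1 C R" for T
    using that by (intro co_converse_co_converse restricted_ferrers_subset[of _ S2 S1]) (simp add: no_zero_row_def)
  ultimately show "bij_betw (co_converse R C) (no_full_column S1 S2 R C) (no_zero_row S2 S1 C R)"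
    by (intro bij_betw_byWitness[where f' = "co_converse C R"] ballI image_subsetI
        co_converse_no_zero_row co_converse_no_full_column)
qed

section \<open>Zero rows versus full columns\<close>

lemma no_zero_row_Int_no_full_column:
  assumes "finite R" "finite C"
  shows "no_zero_row S1 S2 R C \<inter> no_full_column S1 S2 R C =
    (if R = {} \<and> C = {} then {{}} else {})"
proof (cases "R = {} \<and> C = {}")
  case True
  then show ?thesis
    by (auto simp: no_zero_row_def no_full_column_def restricted_ferrers_def ferrers_def)
next
  case False
  have False if T: "T \<in> no_zero_row S1 S2 R C" "T \<in> no_full_column S1 S2 R C" for T
  proof (cases "R = {}")
    case True
    \<comment> \<open>Without rows there is still some column, and it is vacuously full.\<close>
    then show False using T(2) False
      by (auto simp: no_full_column_def restricted_ferrers_def)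
  next
    case R: False
    have sub: "T \<subseteq> R \<times> C" and fer: "ferrers T"
      using T(1) by (auto simp: no_zero_row_def restricted_ferrers_def)
    \<comment> \<open>An entry in a minimal row lies in every row, so its column is full.\<close>
    define i where "i = arg_min_on (\<lambda>i. card (T `` {i})) R"
    have i: "i \<in> R" and min: "card (T `` {i}) \<le> card (T `` {i'})" if "i' \<in> R" for i'
      using arg_min_if_finite(1)[OF assms(1) R] arg_min_least[OF assms(1) R] that
      unfolding i_def by auto
    have iR: "i \<in> R" using i R by blast
    then obtain j where j: "(i, j) \<in> T" using T(1) by (auto simp: no_zero_row_def)
    then have "T\<inverse> `` {j} \<noteq> R" using T(2) sub by (auto simp: no_full_column_def)
    then obtain i' where i': "i' \<in> R" "(i', j) \<notin> T" using sub by auto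
    then have "T `` {i'} \<subset> T `` {i}"
      using ferrers_rows_chain[OF fer, of i i'] j by auto
    moreover have "finite (T `` {i})"
      using finite_subset[OF sub] assms by simp
    ultimately have "card (T `` {i'}) < card (T `` {i})" by (intro psubset_card_mono)
    then show False using min[OF i'(1)] by simp
  qed
  then show ?thesis using False by auto
qed

text \<open>A zero row and a full column would cross in an entry that is both 0 and 1, so the two
  families cover everything. Their overlap at size 0 x 0 becomes the constant 1 in the power series
  identity.\<close>

lemma card_restricted_ferrers_split:
  assumes "finite R" "finite C"
  shows "card (restricted_ferrers S1 S2 R C) + (if R = {} \<and> C = {} then 1 else 0) =
    card (no_zero_row S1 S2 R C) + card (no_full_column S1 S2 R C)"
proof -
  have "restricted_ferrers S1 S2 R C = no_zero_row S1 S2 R C \<union> no_full_column S1 S2 R C"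
    by (auto simp: no_zero_row_def no_full_column_def)
  then show ?thesis
    using card_Un_Int[OF finite_no_zero_row[OF assms] finite_no_full_column[OF assms], of S1 S2 S1 S2]
    by (simp add: no_zero_row_Int_no_full_column[OF assms])
qed

section \<open>Deletion of zero rows\<close>

text \<open>
  Deleting the zero rows \<open>Z\<close> leaves the relation itself unchanged as a set of pairs;
  only the carrier of the rows shrinks.
\<close>

lemma zero_row_fibre:
  assumes "Z \<subseteq> R"
  shows "{T \<in> restricted_ferrers S1 S2 R C. {i \<in> R. T `` {i} = {}} = Z} =
    (if Z = {} \<or> card Z \<in> S1 then no_zero_row S1 S2 (R - Z) C else {})"
proof -
  have "T \<in> restricted_ferrers S1 S2 R C \<longleftrightarrow>
      (Z = {} \<or> card Z \<in> S1) \<and> T \<in> restricted_ferrers S1 S2 (R - Z) C"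
    if Z: "{i \<in> R. T `` {i} = {}} = Z" for T
  proof -
    have a: "T \<subseteq> R \<times> C \<longleftrightarrow> T \<subseteq> (R - Z) \<times> C" using Z by blast
    \<comment> \<open>The zero rows form a single type, so they contribute the one condition
      \<open>card Z \<in> S1\<close>, which is void for empty \<open>Z\<close>.\<close>
    have b: "{i' \<in> R. T `` {i'} = T `` {i}} = Z" if "i \<in> Z" for i
      using that Z by blast
    \<comment> \<open>The type of a nonzero row has no members in \<open>Z\<close>, so deletion
      leaves its size unchanged.\<close>
    have c: "{i' \<in> R. T `` {i'} = T `` {i}} = {i' \<in> R - Z. T `` {i'} = T `` {i}}"
      if "i \<in> R - Z" for i
      using that Z by blast
    have "(\<forall>i\<in>Z. card {i' \<in> R. T `` {i'} = T `` {i}} \<in> S1) \<longleftrightarrow> Z = {} \<or> card Z \<in> S1"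
      by (cases "Z = {}") (auto simp only: b)
    moreover have "(\<forall>i\<in>R - Z. card {i' \<in> R. T `` {i'} = T `` {i}} \<in> S1) \<longleftrightarrow>
        (\<forall>i\<in>R - Z. card {i' \<in> R - Z. T `` {i'} = T `` {i}} \<in> S1)"
      by (intro ball_cong refl) (simp only: c)
    moreover have "(\<forall>i\<in>R. P i) \<longleftrightarrow> (\<forall>i\<in>Z. P i) \<and> (\<forall>i\<in>R - Z. P i)" for P
      using assms by blast
    ultimately have d: "(\<forall>i\<in>R. card {i' \<in> R. T `` {i'} = T `` {i}} \<in> S1) \<longleftrightarrow>
        (Z = {} \<or> card Z \<in> S1) \<and>
        (\<forall>i\<in>R - Z. card {i' \<in> R - Z. T `` {i'} = T `` {i}} \<in> S1)"
      by presburger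
    show ?thesis unfolding restricted_ferrers_def mem_Collect_eq a d by blast
  qed
  moreover have "{i \<in> R. T `` {i} = {}} = Z \<longleftrightarrow> (\<forall>i\<in>R - Z. T `` {i} \<noteq> {})"
    if "T \<subseteq> (R - Z) \<times> C" for T
    using that assms by blast
  ultimately have "T \<in> restricted_ferrers S1 S2 R C \<and> {i \<in> R. T `` {i} = {}} = Z \<longleftrightarrow>
      (Z = {} \<or> card Z \<in> S1) \<and> T \<in> restricted_ferrers S1 S2 (R - Z) C \<and>
      (\<forall>i\<in>R - Z. T `` {i} \<noteq> {})" for T
    using restricted_ferrers_subset[of T S1 S2 "R - Z" C] by blast
  then show ?thesis
    unfolding no_zero_row_def
    by (cases "Z = {} \<or> card Z \<in> S1") (simp_all only: if_True if_False, auto simp only: mem_Collect_eq empty_iff)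
qed

text \<open>Relations are pulled back injectively along the row relabelling \<open>g\<close>.
  Applied also to the inverse of \<open>g\<close>, the inequality yields equality, which later
  replaces \<open>{..<n} - Z\<close> by an initial segment.\<close>

lemma card_no_zero_row_le:
  assumes g: "bij_betw g R' R" and fin: "finite R" "finite C"
  shows "card (no_zero_row S1 S2 R C) \<le> card (no_zero_row S1 S2 R' C)"
proof -
  define h where "h T = {(i', j). i' \<in> R' \<and> (g i', j) \<in> T}" for T :: "('b \<times> 'c) set"
  have gR: "g ` R' = R" and inj: "inj_on g R'" using g by (auto simp: bij_betw_def)
  have "inj_on h (no_zero_row S1 S2 R C)"
  proof (rule inj_onI)
    fix T U assume "T \<in> no_zero_row S1 S2 R C" "U \<in> no_zero_row S1 S2 R C" and eq: "h T = h U"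
    then have "T \<subseteq> R \<times> C" "U \<subseteq> R \<times> C" by (auto simp: no_zero_row_def restricted_ferrers_def)
    moreover have "(g i, j) \<in> T \<longleftrightarrow> (g i, j) \<in> U" if "i \<in> R'" for i j
      using that eq by (auto simp: h_def set_eq_iff)
    ultimately show "T = U" using gR by blast
  qed
  moreover have "h T \<in> no_zero_row S1 S2 R' C" if T: "T \<in> no_zero_row S1 S2 R C" for T
  proof -
    have sub: "T \<subseteq> R \<times> C" and fer: "ferrers T" and ne: "\<forall>i\<in>R. T `` {i} \<noteq> {}"
      and S1: "\<forall>i\<in>R. card {i' \<in> R. T `` {i'} = T `` {i}} \<in> S1"
      and S2: "\<forall>j\<in>C. card {j' \<in> C. T\<inverse> `` {j'} = T\<inverse> `` {j}} \<in> S2"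
      using T by (auto simp: no_zero_row_def restricted_ferrers_def)
    have rows: "h T `` {i} = T `` {g i}" if "i \<in> R'" for i
      using that by (auto simp: h_def)
    \<comment> \<open>\<open>cols\<close> recovers the old columns from the new ones and
      \<open>cols'\<close> the new from the old; together they show that column types are
      preserved.\<close>
    have cols: "g ` ((h T)\<inverse> `` {j}) = T\<inverse> `` {j}" for j
      using gR sub by (auto simp: h_def)
    have cols': "(h T)\<inverse> `` {j} = {i \<in> R'. g i \<in> T\<inverse> `` {j}}" for j
      by (auto simp: h_def)
    have "card {i' \<in> R'. h T `` {i'} = h T `` {i}} \<in> S1" if i: "i \<in> R'" for i
    proof -
      have "{i' \<in> R'. h T `` {i'} = h T `` {i}} = {i' \<in> R'. T `` {g i'} = T `` {g i}}"
        using i rows by (simp cong: conj_cong)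
      moreover have "{k \<in> R. P k} = g ` {i' \<in> R'. P (g i')}" for P
        using gR by blast
      ultimately have "{k \<in> R. T `` {k} = T `` {g i}} = g ` {i' \<in> R'. h T `` {i'} = h T `` {i}}"
        by simp
      moreover have "inj_on g {i' \<in> R'. h T `` {i'} = h T `` {i}}"
        using inj by (rule inj_on_subset) auto
      ultimately have "card {k \<in> R. T `` {k} = T `` {g i}} = card {i' \<in> R'. h T `` {i'} = h T `` {i}}"
        by (simp only: card_image)
      moreover have "g i \<in> R" using gR i by blast
      ultimately show ?thesis using S1 by metis
    qed
    moreover have "(h T)\<inverse> `` {j'} = (h T)\<inverse> `` {j} \<longleftrightarrow> T\<inverse> `` {j'} = T\<inverse> `` {j}" for j j'
    proof
      assume "(h T)\<inverse> `` {j'} = (h T)\<inverse> `` {j}"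
      then show "T\<inverse> `` {j'} = T\<inverse> `` {j}" by (simp only: cols[symmetric])
    qed (simp only: cols')
    moreover have "ferrers (h T)" using fer unfolding ferrers_def h_def by blast
    moreover have "h T \<subseteq> R' \<times> C" using sub by (auto simp: h_def)
    moreover have "\<forall>i\<in>R'. h T `` {i} \<noteq> {}" using rows ne gR by blast
    ultimately show ?thesis
      using S2 by (simp add: no_zero_row_def restricted_ferrers_def)
  qed
  moreover have "finite (no_zero_row S1 S2 R' C)"
    using g fin by (intro finite_no_zero_row) (auto simp: bij_betw_finite)
  ultimately show ?thesis by (intro card_inj_on_le[of h]) auto
qed

lemma card_no_zero_row_cong:
  assumes "finite R" "finite R'" "card R = card R'" "finite C"
  shows "card (no_zero_row S1 S2 R C) = card (no_zero_row S1 S2 R' C)"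
proof -
  obtain g where g: "bij_betw g R R'" using assms finite_same_card_bij by blast
  show ?thesis
    using card_no_zero_row_le[OF g] card_no_zero_row_le[OF bij_betw_inv_into[OF g]] assms
    by (intro antisym) auto
qed

lemma sum_Pow_card:
  fixes f :: "nat \<Rightarrow> nat"
  assumes "finite A"
  shows "(\<Sum>Z\<in>Pow A. f (card Z)) = (\<Sum>s=0..card A. (card A choose s) * f s)"
proof -
  have "(\<Sum>Z\<in>Pow A. f (card Z)) = (\<Sum>s=0..card A. \<Sum>Z\<in>{Z \<in> Pow A. card Z = s}. f (card Z))"
    using assms by (intro sum.group[symmetric]) (auto intro: card_mono)
  also have "\<dots> = (\<Sum>s=0..card A. (card A choose s) * f s)"
    using n_subsets[OF assms] by (intro sum.cong) auto
  finally show ?thesis .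
qed

lemma card_restricted_ferrers_rec:
  fixes n k :: nat
  assumes "0 \<notin> S1"
  shows "card (restricted_ferrers S1 S2 {..<n} {..<k}) =
    card (no_zero_row S1 S2 {..<n} {..<k}) +
    (\<Sum>s=0..n. if s \<in> S1 then (n choose s) * card (no_zero_row S1 S2 {..<n - s} {..<k}) else 0)"
proof -
  let ?L = "restricted_ferrers S1 S2 {..<n} {..<k}"
  let ?z = "\<lambda>T. {i \<in> {..<n}. T `` {i} = {}}"
  let ?p = "\<lambda>m. card (no_zero_row S1 S2 {..<m} {..<k})"
  \<comment> \<open>The cases \<open>Z = {}\<close> and \<open>card Z \<in> S1\<close> exclude each
    other because \<open>0 \<notin> S1\<close>, so the disjunction in the fibre becomes a
    sum.\<close>
  let ?f = "\<lambda>s. (if s = 0 then ?p n else 0) + (if s \<in> S1 then ?p (n - s) else 0)"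
  have "card ?L = (\<Sum>T\<in>?L. 1)"
    by (rule card_eq_sum)
  also have "\<dots> = (\<Sum>Z\<in>Pow {..<n}. \<Sum>T\<in>{T \<in> ?L. ?z T = Z}. 1)"
    by (intro sum.group[symmetric] finite_restricted_ferrers finite_lessThan) auto
  also have "\<dots> = (\<Sum>Z\<in>Pow {..<n}. card {T \<in> ?L. ?z T = Z})"
    by (simp only: card_eq_sum)
  also have "\<dots> = (\<Sum>Z\<in>Pow {..<n}. ?f (card Z))"
  proof (rule sum.cong[OF refl])
    fix Z assume Z: "Z \<in> Pow {..<n}"
    then have fin: "finite Z" using finite_subset by blast
    have "card (no_zero_row S1 S2 ({..<n} - Z) {..<k}) = ?p (n - card Z)"
      using Z fin by (intro card_no_zero_row_cong) (auto simp: card_Diff_subset)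
    then show "card {T \<in> ?L. ?z T = Z} = ?f (card Z)"
      using Z fin assms by (subst zero_row_fibre) auto
  qed
  also have "\<dots> = (\<Sum>s=0..n. (n choose s) * ?f s)"
    using sum_Pow_card[of "{..<n}" ?f] by simp
  also have "\<dots> = (\<Sum>s=0..n. (if s = 0 then ?p n else 0) +
      (if s \<in> S1 then (n choose s) * ?p (n - s) else 0))"
    by (intro sum.cong) auto
  also have "\<dots> = ?p n + (\<Sum>s=0..n. if s \<in> S1 then (n choose s) * ?p (n - s) else 0)"
    by (simp add: sum.distrib)
  finally show ?thesis .
qed

subsection \<open>Lonesum matrices and Ferrers relations\<close>

definition support :: "nat mat \<Rightarrow> (nat \<times> nat) set" where
  "support A = {(i, j). i < dim_row A \<and> j < dim_col A \<and> A $$ (i, j) = 1}"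

lemma zero_one_matD:
  assumes "zero_one_mat A" "i < dim_row A" "j < dim_col A"
  shows "A $$ (i, j) = (if (i, j) \<in> support A then 1 else 0)"
proof -
  have "A $$ (i, j) \<in> elements_mat A" using assms by auto
  then show ?thesis using assms by (auto simp: zero_one_mat_def support_def)
qed

lemma zero_one_matI:
  assumes "\<And>i j. i < dim_row A \<Longrightarrow> j < dim_col A \<Longrightarrow> A $$ (i, j) \<in> {0, 1}"
  shows "zero_one_mat A"
proof -
  have "a \<in> {0, 1}" if "a \<in> elements_mat A" for a
    using elements_matD[OF that] assms by metis
  then show ?thesis unfolding zero_one_mat_def by blast
qed

lemma row_sum_vec_eq_iff:
  assumes "dim_row B = dim_row A" "dim_col B = dim_col A"
  shows "row_sum_vec B = row_sum_vec A \<longleftrightarrow>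
    (\<forall>i<dim_row A. (\<Sum>j<dim_col A. B $$ (i, j)) = (\<Sum>j<dim_col A. A $$ (i, j)))"
  using assms by (auto simp: row_sum_vec_def vec_eq_iff)

lemma col_sum_vec_eq_iff:
  assumes "dim_row B = dim_row A" "dim_col B = dim_col A"
  shows "col_sum_vec B = col_sum_vec A \<longleftrightarrow>
    (\<forall>j<dim_col A. (\<Sum>i<dim_row A. B $$ (i, j)) = (\<Sum>i<dim_row A. A $$ (i, j)))"
  using assms by (auto simp: col_sum_vec_def vec_eq_iff)

lemma support_subset: "support A \<subseteq> {..<dim_row A} \<times> {..<dim_col A}"
  by (auto simp: support_def)

text \<open>
  The weight \<open>w i j\<close> is a function of \<open>i\<close> plus a function of
  \<open>j\<close>, hence its sum over the entries depends only on the row and column sums, and it is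
  positive exactly on the support of \<open>A\<close> and negative elsewhere. So \<open>A\<close> is
  the only maximiser of the weighted sum among the matrices with the same margins.
\<close>

lemma ferrers_support_imp_lonesum:
  assumes A: "zero_one_mat A" and fer: "ferrers (support A)"
  shows "lonesum A"
  unfolding lonesum_def
proof (intro conjI ballI impI A)
  fix B assume B: "B \<in> carrier_mat (dim_row A) (dim_col A)"
    and asm: "zero_one_mat B \<and> row_sum_vec B = row_sum_vec A \<and> col_sum_vec B = col_sum_vec A"
  let ?n = "dim_row A" and ?k = "dim_col A" and ?T = "support A"
  have dims: "dim_row B = ?n" "dim_col B = ?k" using B by auto
  define r where "r i = card (?T `` {i})" for i
  \<comment> \<open>\<open>m j\<close> counts the columns that contain column \<open>j\<close>,
    itself included.\<close>
  define m where "m j = card {j' \<in> {..<?k}. ?T\<inverse> `` {j} \<subseteq> ?T\<inverse> `` {j'}}" for j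
  \<comment> \<open>On the support \<open>m j \<le> r i\<close>, elsewhere \<open>r i < m j\<close>;
    doubling and adding 1 makes the sign strict in both cases.\<close>
  define w where "w i j = (2 * int (r i) + 1) - 2 * int (m j)" for i j
  define d where "d i j = int (A $$ (i, j)) - int (B $$ (i, j))" for i j
  have fin: "finite (?T `` {i})" for i
    by (rule finite_subset[of _ "{..<?k}"]) (auto simp: support_def)
  have pos: "0 < w i j" if "(i, j) \<in> ?T" for i j
  proof -
    have "{j' \<in> {..<?k}. ?T\<inverse> `` {j} \<subseteq> ?T\<inverse> `` {j'}} \<subseteq> ?T `` {i}" using that by blast
    then have "m j \<le> r i" unfolding m_def r_def using fin by (rule card_mono[rotated])
    then show ?thesis by (simp add: w_def)
  qed
  have neg: "w i j < 0" if "(i, j) \<notin> ?T" "j < ?k" for i j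
  proof -
    \<comment> \<open>Columns form a chain, so a column that meets row \<open>i\<close> contains
      column \<open>j\<close>, which does not. The inclusion is strict because \<open>j\<close>
      itself belongs to the right-hand side only.\<close>
    have "?T `` {i} \<subset> {j' \<in> {..<?k}. ?T\<inverse> `` {j} \<subseteq> ?T\<inverse> `` {j'}}"
      using that support_subset[of A] ferrers_rows_chain[OF ferrers_converse[OF fer], of j] by blast
    then have "r i < m j" unfolding m_def r_def by (rule psubset_card_mono[rotated]) simp
    then show ?thesis by (simp add: w_def)
  qed
  have row0: "(\<Sum>j<?k. d i j) = 0" if "i < ?n" for i
    using asm that unfolding row_sum_vec_eq_iff[OF dims]
    by (simp add: d_def sum_subtractf flip: of_nat_sum)
  have col0: "(\<Sum>i<?n. d i j) = 0" if "j < ?k" for j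
    using asm that unfolding col_sum_vec_eq_iff[OF dims]
    by (simp add: d_def sum_subtractf flip: of_nat_sum)
  have entry: "A $$ (i, j) = (if (i, j) \<in> ?T then 1 else 0)" "B $$ (i, j) \<le> 1"
    if "i < ?n" "j < ?k" for i j
    using zero_one_matD[OF A] zero_one_matD[of B] asm dims that by auto
  \<comment> \<open>Entries of \<open>B\<close> lie between 0 and 1, so \<open>d\<close> is
    nonnegative on the support and nonpositive off it, matching the sign of
    \<open>w\<close>.\<close>
  have nonneg: "0 \<le> d i j * w i j" if "i < ?n" "j < ?k" for i j
    using entry[OF that] pos[of i j] neg[of i j] that
    by (cases "(i, j) \<in> ?T") (auto simp: d_def mult_nonneg_nonpos)
  \<comment> \<open>The row part and the column part of \<open>w\<close> are summed separately; each
    vanishes by equality of the margins.\<close>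
  have "(\<Sum>i<?n. \<Sum>j<?k. d i j * w i j) =
      (\<Sum>i<?n. (\<Sum>j<?k. d i j) * (2 * int (r i) + 1)) - (\<Sum>i<?n. \<Sum>j<?k. d i j * (2 * int (m j)))"
    by (simp only: w_def right_diff_distrib sum_subtractf sum_distrib_right)
  also have "(\<Sum>i<?n. \<Sum>j<?k. d i j * (2 * int (m j))) = (\<Sum>j<?k. (\<Sum>i<?n. d i j) * (2 * int (m j)))"
    by (subst sum.swap) (simp only: sum_distrib_right)
  finally have "(\<Sum>i<?n. \<Sum>j<?k. d i j * w i j) = 0"
    by (simp add: row0 col0)
  then have "(\<Sum>j<?k. d i j * w i j) = 0" if "i < ?n" for i
    using that nonneg by (subst (asm) sum_nonneg_eq_0_iff) (auto intro!: sum_nonneg)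
  then have "d i j * w i j = 0" if "i < ?n" "j < ?k" for i j
    using that nonneg sum_nonneg_eq_0_iff[of "{..<?k}" "\<lambda>j. d i j * w i j"] by auto
  then have "d i j = 0" if "i < ?n" "j < ?k" for i j
    using that pos[of i j] neg[of i j] by fastforce
  then show "B = A" using dims by (intro eq_matI) (auto simp: d_def)
qed

text \<open>Replacing an excluded 2 x 2 pattern by the other one changes the matrix but none of its
  row and column sums.\<close>

lemma lonesum_imp_ferrers_support:
  assumes "lonesum A"
  shows "ferrers (support A)"
proof (rule ccontr)
  assume "\<not> ferrers (support A)"
  then obtain i j i' j' where
    T: "(i, j) \<in> support A" "(i', j') \<in> support A" "(i, j') \<notin> support A" "(i', j) \<notin> support A"
    unfolding ferrers_def by blast
  let ?n = "dim_row A" and ?k = "dim_col A"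
  have A: "zero_one_mat A" using assms by (simp add: lonesum_def)
  have lt: "i < ?n" "i' < ?n" "j < ?k" "j' < ?k" using T by (auto simp: support_def)
  have ne: "i \<noteq> i'" "j \<noteq> j'" using T by auto
  have val: "A $$ (i, j) = 1" "A $$ (i', j') = 1" "A $$ (i, j') = 0" "A $$ (i', j) = 0"
    using zero_one_matD[OF A] lt T by auto
  \<comment> \<open>Exchanging columns \<open>j\<close>, \<open>j'\<close> in rows \<open>i\<close>, \<open>i'\<close> only has the
    same effect as exchanging rows \<open>i\<close>, \<open>i'\<close> in columns \<open>j\<close>, \<open>j'\<close> only; hence both margins survive.\<close>
  define B where "B = mat ?n ?k (\<lambda>(a, b).
    if a \<in> {i, i'} then A $$ (a, transpose j j' b) else A $$ (a, b))"
  have dims: "dim_row B = ?n" "dim_col B = ?k" by (auto simp: B_def)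
  have pj: "transpose j j' permutes {..<?k}" and pi: "transpose i i' permutes {..<?n}"
    using lt by (auto intro: permutes_swap_id)
  have B1: "B $$ (a, b) = (if a \<in> {i, i'} then A $$ (a, transpose j j' b) else A $$ (a, b))"
    if "a < ?n" "b < ?k" for a b
    using that by (simp add: B_def)
  have B2: "B $$ (a, b) = (if b \<in> {j, j'} then A $$ (transpose i i' a, b) else A $$ (a, b))"
    if "a < ?n" "b < ?k" for a b
    using that val ne by (auto simp: B1 transpose_def)
  have "transpose j j' b < ?k" if "b < ?k" for b
    using that lt by (auto simp: transpose_def)
  then have "zero_one_mat B"
    using zero_one_matD[OF A] by (intro zero_one_matI) (auto simp: dims B1)
  moreover have "row_sum_vec B = row_sum_vec A"
    unfolding row_sum_vec_eq_iff[OF dims]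
  proof (intro allI impI)
    fix a assume a: "a < ?n"
    show "(\<Sum>b<?k. B $$ (a, b)) = (\<Sum>b<?k. A $$ (a, b))"
      using sum.permute[OF pj, of "\<lambda>b. A $$ (a, b)"] a
      by (cases "a \<in> {i, i'}") (simp_all add: B1 comp_def)
  qed
  moreover have "col_sum_vec B = col_sum_vec A"
    unfolding col_sum_vec_eq_iff[OF dims]
  proof (intro allI impI)
    fix b assume b: "b < ?k"
    show "(\<Sum>a<?n. B $$ (a, b)) = (\<Sum>a<?n. A $$ (a, b))"
      using sum.permute[OF pi, of "\<lambda>a. A $$ (a, b)"] b
      by (cases "b \<in> {j, j'}") (simp_all add: B2 comp_def)
  qed
  moreover have "B \<in> carrier_mat ?n ?k" using dims by auto
  ultimately have "B = A" using assms unfolding lonesum_def by blast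
  then show False using B1[of i j] lt val by simp
qed

section \<open>Row and column types read off the support\<close>

lemma row_eq_iff_support:
  assumes "zero_one_mat A" "i < dim_row A" "i' < dim_row A"
  shows "row A i' = row A i \<longleftrightarrow> support A `` {i'} = support A `` {i}"
proof
  assume "row A i' = row A i"
  then have "A $$ (i', j) = A $$ (i, j)" if "j < dim_col A" for j
    using that assms by (metis index_row(1))
  then show "support A `` {i'} = support A `` {i}"
    using assms by (auto simp: support_def)
next
  assume "support A `` {i'} = support A `` {i}"
  then have "(i', j) \<in> support A \<longleftrightarrow> (i, j) \<in> support A" for j by blast
  then show "row A i' = row A i"
    using assms zero_one_matD[OF assms(1)] by (intro eq_vecI) auto
qed

lemma col_eq_iff_support:
  assumes "zero_one_mat A" "j < dim_col A" "j' < dim_col A"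
  shows "col A j' = col A j \<longleftrightarrow> (support A)\<inverse> `` {j'} = (support A)\<inverse> `` {j}"
proof
  assume "col A j' = col A j"
  then have "A $$ (i, j') = A $$ (i, j)" if "i < dim_row A" for i
    using that assms by (metis index_col)
  then show "(support A)\<inverse> `` {j'} = (support A)\<inverse> `` {j}"
    using assms by (auto simp: support_def)
next
  assume "(support A)\<inverse> `` {j'} = (support A)\<inverse> `` {j}"
  then have "(i, j') \<in> support A \<longleftrightarrow> (i, j) \<in> support A" for i by blast
  then show "col A j' = col A j"
    using assms zero_one_matD[OF assms(1)] by (intro eq_vecI) auto
qed

lemma restricted_lonesum_iff_support:
  assumes "zero_one_mat A"
  shows "restricted_lonesum S1 S2 A \<longleftrightarrow>
    support A \<in> restricted_ferrers S1 S2 {..<dim_row A} {..<dim_col A}"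
proof -
  have "lonesum A \<longleftrightarrow> ferrers (support A)"
    using assms ferrers_support_imp_lonesum lonesum_imp_ferrers_support by blast
  moreover have "{i'. i' < dim_row A \<and> row A i' = row A i} =
      {i' \<in> {..<dim_row A}. support A `` {i'} = support A `` {i}}" if "i < dim_row A" for i
    using row_eq_iff_support[OF assms that] by (simp cong: conj_cong)
  moreover have "{j'. j' < dim_col A \<and> col A j' = col A j} =
      {j' \<in> {..<dim_col A}. (support A)\<inverse> `` {j'} = (support A)\<inverse> `` {j}}" if "j < dim_col A" for j
    using col_eq_iff_support[OF assms that] by (simp cong: conj_cong)
  ultimately show ?thesis
    using support_subset[of A] by (simp add: restricted_lonesum_def restricted_ferrers_def Ball_def)
qed

lemma card_restricted_lonesum:
  "card {M \<in> carrier_mat n k. restricted_lonesum S1 S2 M} =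
    card (restricted_ferrers S1 S2 {..<n} {..<k})"
proof (rule bij_betw_same_card)
  define g where "g T = mat n k (\<lambda>p. if p \<in> T then 1 else 0 :: nat)" for T
  let ?M = "{M \<in> carrier_mat n k. restricted_lonesum S1 S2 M}"
  have zo: "zero_one_mat M" if "M \<in> ?M" for M
    using that by (simp add: restricted_lonesum_def lonesum_def)
  have g: "g T \<in> carrier_mat n k" "zero_one_mat (g T)" for T
    by (auto simp: g_def intro!: zero_one_matI split: if_splits)
  have sg: "support (g T) = T" if "T \<subseteq> {..<n} \<times> {..<k}" for T
    using that by (auto simp: support_def g_def split: if_splits)
  show "bij_betw support ?M (restricted_ferrers S1 S2 {..<n} {..<k})"
  proof (rule bij_betw_byWitness[where f' = g])
    show "\<forall>M\<in>?M. g (support M) = M"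
    proof
      fix M assume M: "M \<in> ?M"
      then show "g (support M) = M"
        using zero_one_matD[OF zo[OF M]] by (intro eq_matI) (auto simp: g_def)
    qed
    show "\<forall>T\<in>restricted_ferrers S1 S2 {..<n} {..<k}. support (g T) = T"
      by (intro ballI sg restricted_ferrers_subset)
    show "support ` ?M \<subseteq> restricted_ferrers S1 S2 {..<n} {..<k}"
    proof (rule image_subsetI)
      fix M assume M: "M \<in> ?M"
      then show "support M \<in> restricted_ferrers S1 S2 {..<n} {..<k}"
        using restricted_lonesum_iff_support[OF zo[OF M], of S1 S2] by auto
    qed
    show "g ` restricted_ferrers S1 S2 {..<n} {..<k} \<subseteq> ?M"
    proof (rule image_subsetI)
      fix T assume T: "T \<in> restricted_ferrers S1 S2 {..<n} {..<k}"
      have "restricted_lonesum S1 S2 (g T)"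
        using T restricted_lonesum_iff_support[OF g(2)] g(1)[of T]
        by (simp add: sg[OF restricted_ferrers_subset[OF T]])
      then show "g T \<in> ?M" using g(1) by simp
    qed
  qed
qed

subsection \<open>Generating functions\<close>

definition egf :: "(nat \<Rightarrow> nat \<Rightarrow> nat) \<Rightarrow> rat fps fps" where
  "egf a = Abs_fps (\<lambda>k. Abs_fps (\<lambda>n. of_nat (a n k) / (fact n * fact k)))"

lemma egf_nth: "fps_nth (fps_nth (egf a) k) n = of_nat (a n k) / (fact n * fact k)"
  by (simp add: egf_def)

text \<open>The recurrence is a binomial convolution in the row index: the summand 1 stands for no
  zero rows, \<open>E S\<close> for a class of \<open>s\<close> zero rows.\<close>

lemma egf_eq_in_x_mult:
  assumes "\<And>n k. b n k = a n k + (\<Sum>s=0..n. if s \<in> S then (n choose s) * a (n - s) k else 0)"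
  shows "egf b = (1 + in_x (E S)) * egf a"
proof (intro fps_ext)
  fix k n
  have "of_nat (if s \<in> S then (n choose s) * a (n - s) k else 0) / (fact n * fact k) =
      (if s \<in> S then 1 / fact s else 0) * (of_nat (a (n - s) k) / (fact (n - s) * fact k) :: rat)"
    if "s \<le> n" for s
    using that by (simp add: binomial_fact field_simps)
  then show "fps_nth (fps_nth (egf b) k) n = fps_nth (fps_nth ((1 + in_x (E S)) * egf a) k) n"
    \<comment> \<open>The instance \<open>Abs_fps _\<close> confines the Cauchy product to the
      factor coming from \<open>E S\<close>, so that multiplication by \<open>fps_const\<close> is
      not expanded as a convolution.\<close>
    by (simp add: assms distrib_right in_x_def egf_nth fps_mult_nth[of "Abs_fps _"] E_def
        add_divide_distrib sum_divide_distrib)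
qed

lemma egf_eq_in_y_mult:
  assumes "\<And>n k. b n k = a n k + (\<Sum>s=0..k. if s \<in> S then (k choose s) * a n (k - s) else 0)"
  shows "egf b = (1 + in_y (E S)) * egf a"
proof (intro fps_ext)
  fix k n
  have "of_nat (if s \<in> S then (k choose s) * a n (k - s) else 0) / (fact n * fact k) =
      (if s \<in> S then 1 / fact s else 0) * (of_nat (a n (k - s)) / (fact n * fact (k - s)) :: rat)"
    if "s \<le> k" for s
    using that by (simp add: binomial_fact field_simps)
  then show "fps_nth (fps_nth (egf b) k) n = fps_nth (fps_nth ((1 + in_y (E S)) * egf a) k) n"
    by (simp add: assms distrib_right in_y_def egf_nth fps_mult_nth[of "Abs_fps _"] fps_sum_nth
        E_def add_divide_distrib sum_divide_distrib)
qed

lemma lonesum_gf_eq_egf: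
  "lonesum_gf S1 S2 = egf (\<lambda>n k. card (restricted_ferrers S1 S2 {..<n} {..<k}))"
proof (intro fps_ext)
  fix k n
  have "(\<Sum>M \<in> {M \<in> carrier_mat n k. restricted_lonesum S1 S2 M}.
       1 / fact (dim_row M) * (1 / fact (dim_col M))) =
    (\<Sum>M \<in> {M \<in> carrier_mat n k. restricted_lonesum S1 S2 M}. 1 / (fact n * fact k) :: rat)"
    by (intro sum.cong) auto
  then show "fps_nth (fps_nth (lonesum_gf S1 S2) k) n =
      fps_nth (fps_nth (egf (\<lambda>n k. card (restricted_ferrers S1 S2 {..<n} {..<k}))) k) n"
    by (simp add: lonesum_gf_def egf_nth card_restricted_lonesum)
qed

theorem theorem10:
  fixes S1 S2 :: "nat set"
  assumes "S1 \<subseteq> {0<..}" and "S2 \<subseteq> {0<..}"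
  shows "lonesum_gf S1 S2 =
    (1 + in_x (E S1) + in_y (E S2) + in_x (E S1) * in_y (E S2)) /
    (1 - in_x (E S1) * in_y (E S2))"
proof -
  define P where "P = egf (\<lambda>n k. card (no_zero_row S1 S2 {..<n} {..<k}))"
  define Q where "Q = egf (\<lambda>n k. card (no_full_column S1 S2 {..<n} {..<k}))"
  let ?L = "lonesum_gf S1 S2" and ?x = "in_x (E S1)" and ?y = "in_y (E S2)"
  have S0: "0 \<notin> S1" "0 \<notin> S2" using assms by auto
  have LP: "?L = (1 + ?x) * P"
    unfolding lonesum_gf_eq_egf P_def
    by (intro egf_eq_in_x_mult card_restricted_ferrers_rec S0)
  \<comment> \<open>After complementation and transposition \<open>Q\<close> counts relations
    without zero rows, with \<open>S1\<close>, \<open>S2\<close> and the two indices exchanged; the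
    same recurrence then acts on the column index.\<close>
  have LQ: "?L = (1 + ?y) * Q"
    unfolding lonesum_gf_eq_egf Q_def card_no_full_column card_restricted_ferrers_swap[of S1]
    by (intro egf_eq_in_y_mult card_restricted_ferrers_rec S0)
  have "?L + 1 = P + Q"
  proof (intro fps_ext)
    fix k n
    show "fps_nth (fps_nth (?L + 1) k) n = fps_nth (fps_nth (P + Q) k) n"
      using card_restricted_ferrers_split[of "{..<n}" "{..<k}" S1 S2]
      by (auto simp: lonesum_gf_eq_egf P_def Q_def egf_nth lessThan_empty_iff
          simp flip: add_divide_distrib of_nat_add split: if_splits)
  qed
  \<comment> \<open>Multiplying by both factors lets \<open>P\<close> and \<open>Q\<close> each be
    absorbed into \<open>?L\<close> without any division.\<close>
  then have "(1 + ?x) * (1 + ?y) * (?L + 1) = (1 + ?y) * ((1 + ?x) * P) + (1 + ?x) * ((1 + ?y) * Q)"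
    by (simp add: algebra_simps)
  then have "?L * (1 - ?x * ?y) = 1 + ?x + ?y + ?x * ?y"
    unfolding LP[symmetric] LQ[symmetric] by (simp add: algebra_simps)
  \<comment> \<open>Needed to cancel the denominator; its constant coefficient in y is 1 because
    \<open>E S2\<close> has no constant term.\<close>
  moreover have "1 - ?x * ?y \<noteq> 0"
  proof
    assume "1 - ?x * ?y = 0"
    then have "fps_nth (1 - ?x * ?y) 0 = 0" by simp
    then show False using S0 by (simp add: in_x_def in_y_def E_def)
  qed
  ultimately show ?thesis
    using lonesum_denominator_divide[OF S0(2), of "1 + ?x + ?y + ?x * ?y" S1]
    by (metis mult_right_cancel)
qed

end
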